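(* For every integer $d\geq 2$, the group $\mathrm{BMS}_d = C^\infty(\mathbb{S}^d)\rtimes_\sigma \mathrm{SO}_{1,d+1}(\mathbb{R})_0$ is not locally exponential. In particular, the Bondi--Metzner--Sachs group $\mathrm{BMS}=\mathrm{BMS}_2$ is not locally exponential.
   Context: $\mathrm{SO}_{1,d+1}(\mathbb{R})_0$ is the identity component of the Lorentz group of $\mathbb{R}^{1,d+1}$ (quadratic form $x_0^2-\|x\|^2$). Write its elements in block form $g=\begin{pmatrix} a & b\\ c & m\end{pmatrix}$ with $a\in\mathbb{R}$, $b\in M_{1,d+1}(\mathbb{R})$, $c\in\mathbb{R}^{d+1}$, $m\in M_{d+1}(\mathbb{R})$. It acts on the unit sphere $\mathbb{S}^d\subseteq\mathbb{R}^{d+1}$ by $g.x=(a+bx)^{-1}(c+mx)$. The conformal factors $J_g(x):=(a+bx)^{-1}$, $x\in\mathbb{S}^d$, satisfy $J_{g_1g_2}(x)=J_{g_1}(g_2.x)J_{g_2}(x)$, and $(\sigma_{g^{-1}}f)(x):=J_g(x)f(g.x)$ defines a smooth left linear action $\sigma$ of $\mathrm{SO}_{1,d+1}(\mathbb{R})_0$ on the Fréchet space $C^\infty(\mathbb{S}^d)=C^\infty(\mathbb{S}^d,\mathbb{R})$ (with the $C^\infty$-topology of uniform convergence of all derivatives). For a Lie group $G$ acting smoothly and linearly on a locally convex space $E$ by $\sigma$, $E\rtimes_\sigma G$ is the Lie group on $E\times G$ with product $(v,g)(w,h)=(v+\sigma_g w,gh)$. Smoothness is in the sense of Bastiani: all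 iterated directional derivatives exist and are jointly continuous. An exponential function of a Lie group $H$ with Lie algebra $\mathbf{L}(H)$ is a smooth map $\exp:\mathbf{L}(H)\to H$ such that for each $x$, $t\mapsto\exp(tx)$ is a one-parameter group with derivative $x$ at $t=0$. $H$ is locally exponential if it has an exponential function which maps some open $0$-neighborhood in $\mathbf{L}(H)$ diffeomorphically onto an open neighborhood of the identity in $H$. *)

theory Defs
  imports "HOL-Analysis.Analysis" "HOL-Algebra.Group"
begin

section \<open>Bastiani calculus\<close>

definition has_dir_deriv ::
  "('a::real_vector \<Rightarrow> 'b::{real_vector,t2_space}) \<Rightarrow> 'a \<Rightarrow> 'a \<Rightarrow> 'b \<Rightarrow> bool" where
  "has_dir_deriv f x v D \<longleftrightarrow>
     ((\<lambda>t::real. (f (x + t *\<^sub>R v) - f x) /\<^sub>R t) \<longlongrightarrow> D) (at 0)"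

definition dir_deriv ::
  "('a::real_vector \<Rightarrow> 'b::{real_vector,t2_space}) \<Rightarrow> 'a \<Rightarrow> 'a \<Rightarrow> 'b" where
  "dir_deriv f x v = Lim (at (0::real)) (\<lambda>t. (f (x + t *\<^sub>R v) - f x) /\<^sub>R t)"

text \<open>The directions of the \<open>k\<close>-th iterated derivative are the entries \<open>v 0, \<dots>, v (k - 1)\<close> of a
  sequence \<open>v\<close>; the remaining entries are irrelevant.\<close>

fun iter_deriv ::
  "nat \<Rightarrow> ('a::real_vector \<Rightarrow> 'b::{real_vector,t2_space}) \<Rightarrow> 'a \<Rightarrow> (nat \<Rightarrow> 'a) \<Rightarrow> 'b" where
  "iter_deriv 0 f x v = f x"
| "iter_deriv (Suc k) f x v = dir_deriv (\<lambda>y. iter_deriv k f y v) x (v k)"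

text \<open>Joint continuity on \<open>U \<times> E\<^sup>k\<close> is stated on \<open>U \<times> E\<^sup>\<nat>\<close> with the product topology. This is the same,
  since \<open>iter_deriv k\<close> only depends on the first \<open>k\<close> directions and \<open>E\<^sup>\<nat> \<rightarrow> E\<^sup>k\<close> is an open surjection.\<close>

definition bastiani_smooth ::
  "'a::{real_vector,t2_space} set \<Rightarrow> ('a \<Rightarrow> 'b::{real_vector,t2_space}) \<Rightarrow> bool" where
  "bastiani_smooth U f \<longleftrightarrow> open U \<and>
     (\<forall>k. (\<forall>x\<in>U. \<forall>v. \<exists>D. has_dir_deriv (\<lambda>y. iter_deriv k f y v) x (v k) D) \<and>
          continuous_on (U \<times> UNIV) (\<lambda>(x, v). iter_deriv k f x v))"

text \<open>Smoothness on a subset \<open>A\<close>: locally the restriction of a smooth map on an open set of the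
  ambient space. For a (split) submanifold \<open>A\<close> this is smoothness for the submanifold structure.\<close>

definition smooth_map_on ::
  "'a::{real_vector,t2_space} set \<Rightarrow> ('a \<Rightarrow> 'b::{real_vector,t2_space}) \<Rightarrow> bool" where
  "smooth_map_on A f \<longleftrightarrow>
     (\<forall>x\<in>A. \<exists>U F. x \<in> U \<and> bastiani_smooth U F \<and> (\<forall>y\<in>A \<inter> U. F y = f y))"

definition diffeo_between ::
  "'a::{real_vector,t2_space} set \<Rightarrow> 'b::{real_vector,t2_space} set \<Rightarrow> ('a \<Rightarrow> 'b) \<Rightarrow> bool" where
  "diffeo_between A B f \<longleftrightarrow>
     bij_betw f A B \<and> smooth_map_on A f \<and> smooth_map_on B (inv_into A f)"


section \<open>Locally exponential Lie groups\<close>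

text \<open>A Lie group \<open>H\<close> is given here as a group whose carrier is a split submanifold of an ambient
  locally convex space, from which it takes its topology and smooth structure. Tangent vectors at
  the identity are then velocities in the ambient space, and the Lie algebra is a subspace of it.\<close>

definition lie_algebra :: "'v::{real_vector,t2_space} monoid \<Rightarrow> 'v set" where
  "lie_algebra H = {x. \<exists>\<gamma>::real \<Rightarrow> 'v. bastiani_smooth UNIV \<gamma> \<and> range \<gamma> \<subseteq> carrier H \<and>
     \<gamma> 0 = \<one>\<^bsub>H\<^esub> \<and> has_dir_deriv \<gamma> 0 1 x}"

definition exponential_function ::
  "'v::{real_vector,t2_space} monoid \<Rightarrow> ('v \<Rightarrow> 'v) \<Rightarrow> bool" where
  "exponential_function H e \<longleftrightarrow>
     e ` lie_algebra H \<subseteq> carrier H \<and> smooth_map_on (lie_algebra H) e \<and>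
     (\<forall>x\<in>lie_algebra H.
        (\<forall>s t::real. e ((s + t) *\<^sub>R x) = e (s *\<^sub>R x) \<otimes>\<^bsub>H\<^esub> e (t *\<^sub>R x)) \<and>
        e (0 *\<^sub>R x) = \<one>\<^bsub>H\<^esub> \<and>
        has_dir_deriv (\<lambda>t::real. e (t *\<^sub>R x)) 0 1 x)"

definition locally_exponential :: "'v::{real_vector,t2_space} monoid \<Rightarrow> bool" where
  "locally_exponential H \<longleftrightarrow>
     (\<exists>e. exponential_function H e \<and>
        (\<exists>U V. openin (top_of_set (lie_algebra H)) U \<and> 0 \<in> U \<and>
               openin (top_of_set (carrier H)) V \<and> \<one>\<^bsub>H\<^esub> \<in> V \<and>
               diffeo_between U V e))"


section \<open>Smooth functions on the unit sphere\<close>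

lemma dir_deriv_eqI: "has_dir_deriv f x v D \<Longrightarrow> dir_deriv f x v = D"
  unfolding has_dir_deriv_def dir_deriv_def by (rule tendsto_Lim) auto

lemma has_dir_deriv_cong:
  fixes x :: "'a::real_normed_vector"
  assumes "open U" "x \<in> U" "\<And>y. y \<in> U \<Longrightarrow> f y = g y" "has_dir_deriv f x v D"
  shows "has_dir_deriv g x v D"
proof -
  have "((\<lambda>t::real. x + t *\<^sub>R v) \<longlongrightarrow> x + 0 *\<^sub>R v) (at 0)" by (intro tendsto_intros)
  then have "\<forall>\<^sub>F t in at (0::real). x + t *\<^sub>R v \<in> U"
    using assms(1,2) by (auto simp: tendsto_def)
  then have "\<forall>\<^sub>F t in at (0::real).
      (f (x + t *\<^sub>R v) - f x) /\<^sub>R t = (g (x + t *\<^sub>R v) - g x) /\<^sub>R t"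
    by eventually_elim (use assms(2,3) in auto)
  with assms(4) show ?thesis
    unfolding has_dir_deriv_def by (rule Lim_transform_eventually)
qed

lemma has_dir_deriv_lincomb:
  fixes f g :: "'a::real_normed_vector \<Rightarrow> 'b::real_normed_vector"
  assumes "has_dir_deriv f x v D" "has_dir_deriv g x v D'"
  shows "has_dir_deriv (\<lambda>y. a *\<^sub>R f y + b *\<^sub>R g y) x v (a *\<^sub>R D + b *\<^sub>R D')"
proof -
  have "((\<lambda>t. a *\<^sub>R ((f (x + t *\<^sub>R v) - f x) /\<^sub>R t) + b *\<^sub>R ((g (x + t *\<^sub>R v) - g x) /\<^sub>R t))
      \<longlongrightarrow> a *\<^sub>R D + b *\<^sub>R D') (at 0)"
    using assms unfolding has_dir_deriv_def by (intro tendsto_intros)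
  then show ?thesis
    unfolding has_dir_deriv_def by (simp add: algebra_simps)
qed

lemma iter_deriv_lincomb:
  fixes f g :: "'a::real_normed_vector \<Rightarrow> 'b::real_normed_vector"
  assumes "bastiani_smooth U f" "bastiani_smooth U g" "x \<in> U"
  shows "iter_deriv k (\<lambda>y. a *\<^sub>R f y + b *\<^sub>R g y) x v
       = a *\<^sub>R iter_deriv k f x v + b *\<^sub>R iter_deriv k g x v"
    and "has_dir_deriv (\<lambda>z. iter_deriv k (\<lambda>y. a *\<^sub>R f y + b *\<^sub>R g y) z v) x (v k)
       (a *\<^sub>R iter_deriv (Suc k) f x v + b *\<^sub>R iter_deriv (Suc k) g x v)"
proof -
  let ?h = "\<lambda>y. a *\<^sub>R f y + b *\<^sub>R g y"
  have opU: "open U" using assms(1) by (simp add: bastiani_smooth_def)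
  have step: "has_dir_deriv (\<lambda>z. iter_deriv k ?h z v) x (v k)
       (a *\<^sub>R iter_deriv (Suc k) f x v + b *\<^sub>R iter_deriv (Suc k) g x v)"
    if IH: "\<forall>z\<in>U. iter_deriv k ?h z v = a *\<^sub>R iter_deriv k f z v + b *\<^sub>R iter_deriv k g z v"
      and x: "x \<in> U" for k x
  proof -
    obtain D D' where D: "has_dir_deriv (\<lambda>y. iter_deriv k f y v) x (v k) D"
        and D': "has_dir_deriv (\<lambda>y. iter_deriv k g y v) x (v k) D'"
      using assms(1,2) x unfolding bastiani_smooth_def by meson
    have "has_dir_deriv (\<lambda>y. a *\<^sub>R iter_deriv k f y v + b *\<^sub>R iter_deriv k g y v) x (v k)
        (a *\<^sub>R D + b *\<^sub>R D')"
      by (rule has_dir_deriv_lincomb[OF D D'])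
    then have "has_dir_deriv (\<lambda>z. iter_deriv k ?h z v) x (v k) (a *\<^sub>R D + b *\<^sub>R D')"
      by (rule has_dir_deriv_cong[OF opU x, rotated]) (use IH in auto)
    then show ?thesis by (simp add: dir_deriv_eqI[OF D] dir_deriv_eqI[OF D'])
  qed
  have all: "\<forall>z\<in>U. iter_deriv k ?h z v = a *\<^sub>R iter_deriv k f z v + b *\<^sub>R iter_deriv k g z v" for k
  proof (induction k)
    case 0
    show ?case by simp
  next
    case (Suc k)
    show ?case using dir_deriv_eqI[OF step[OF Suc]] by simp
  qed
  show "iter_deriv k ?h x v = a *\<^sub>R iter_deriv k f x v + b *\<^sub>R iter_deriv k g x v"
    using all assms(3) by blast
  show "has_dir_deriv (\<lambda>z. iter_deriv k ?h z v) x (v k)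
       (a *\<^sub>R iter_deriv (Suc k) f x v + b *\<^sub>R iter_deriv (Suc k) g x v)"
    by (rule step[OF all assms(3)])
qed

lemma bastiani_smooth_lincomb:
  fixes f g :: "'a::real_normed_vector \<Rightarrow> 'b::real_normed_vector"
  assumes "bastiani_smooth U f" "bastiani_smooth U g"
  shows "bastiani_smooth U (\<lambda>y. a *\<^sub>R f y + b *\<^sub>R g y)"
  unfolding bastiani_smooth_def
proof (intro conjI allI ballI)
  show "open U" using assms(1) by (simp add: bastiani_smooth_def)
next
  fix k x and v :: "nat \<Rightarrow> 'a"
  assume "x \<in> U"
  then show "\<exists>D. has_dir_deriv (\<lambda>z. iter_deriv k (\<lambda>y. a *\<^sub>R f y + b *\<^sub>R g y) z v) x (v k) D"
    using iter_deriv_lincomb(2)[OF assms] by blast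
next
  fix k
  have "continuous_on (U \<times> UNIV) (\<lambda>p. a *\<^sub>R (\<lambda>(x, v). iter_deriv k f x v) p
      + b *\<^sub>R (\<lambda>(x, v). iter_deriv k g x v) p)"
    using assms unfolding bastiani_smooth_def by (intro continuous_intros) auto
  then show "continuous_on (U \<times> UNIV) (\<lambda>(x, v). iter_deriv k (\<lambda>y. a *\<^sub>R f y + b *\<^sub>R g y) x v)"
    by (rule continuous_on_cong[THEN iffD1, rotated -1])
       (auto simp: iter_deriv_lincomb(1)[OF assms])
qed

lemma bastiani_smooth_subset:
  "bastiani_smooth U f \<Longrightarrow> open V \<Longrightarrow> V \<subseteq> U \<Longrightarrow> bastiani_smooth V f"
  unfolding bastiani_smooth_def
  by (meson Sigma_mono continuous_on_subset order_refl subsetD)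

lemma smooth_map_on_lincomb:
  fixes f g :: "'a::real_normed_vector \<Rightarrow> 'b::real_normed_vector"
  assumes "smooth_map_on A f" "smooth_map_on A g"
  shows "smooth_map_on A (\<lambda>y. a *\<^sub>R f y + b *\<^sub>R g y)"
  unfolding smooth_map_on_def
proof
  fix x assume "x \<in> A"
  then obtain U F V G where U: "x \<in> U" "bastiani_smooth U F" "\<forall>y\<in>A \<inter> U. F y = f y"
    and V: "x \<in> V" "bastiani_smooth V G" "\<forall>y\<in>A \<inter> V. G y = g y"
    using assms unfolding smooth_map_on_def by metis
  have "open (U \<inter> V)" using U(2) V(2) by (auto simp: bastiani_smooth_def)
  then have "bastiani_smooth (U \<inter> V) (\<lambda>y. a *\<^sub>R F y + b *\<^sub>R G y)"
    by (intro bastiani_smooth_lincomb bastiani_smooth_subset[OF U(2)]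
        bastiani_smooth_subset[OF V(2)]) auto
  with U V show "\<exists>U H. x \<in> U \<and> bastiani_smooth U H \<and>
      (\<forall>y\<in>A \<inter> U. H y = a *\<^sub>R f y + b *\<^sub>R g y)"
    by (intro exI[of _ "U \<inter> V"] exI[of _ "\<lambda>y. a *\<^sub>R F y + b *\<^sub>R G y"]) auto
qed

lemma smooth_map_on_zero:
  "smooth_map_on A (\<lambda>_::'a::real_normed_vector. 0::'b::real_normed_vector)"
proof -
  have d: "has_dir_deriv (\<lambda>_::'a. 0::'b) x v 0" for x v
    by (simp add: has_dir_deriv_def)
  have i: "iter_deriv k (\<lambda>_::'a. 0::'b) x v = 0" for k x v
    by (induction k arbitrary: x) (auto simp: dir_deriv_eqI[OF d])
  have "bastiani_smooth UNIV (\<lambda>_::'a. 0::'b)"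
    unfolding bastiani_smooth_def i using d by (auto simp: split_def)
  then show ?thesis unfolding smooth_map_on_def by blast
qed

text \<open>For \<open>CARD('n) = d + 1\<close> this is the space of smooth real functions on the unit \<open>d\<close>-sphere in
  \<open>\<real>\<^sup>d\<^sup>+\<^sup>1\<close>, each function being represented by its extension by \<open>0\<close> to the ambient space.\<close>

typedef (overloaded) ('n::finite) sphere_fun =
  "{f :: real ^ 'n \<Rightarrow> real. smooth_map_on (sphere 0 1) f \<and> (\<forall>x. x \<notin> sphere 0 1 \<longrightarrow> f x = 0)}"
  morphisms sphere_apply Abs_sphere_fun
proof
  show "(\<lambda>_. 0) \<in> {f :: real ^ 'n \<Rightarrow> real.
      smooth_map_on (sphere 0 1) f \<and> (\<forall>x. x \<notin> sphere 0 1 \<longrightarrow> f x = 0)}"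
    by (simp add: smooth_map_on_zero)
qed

lemma sphere_fun_lincomb:
  "(\<lambda>x. a * sphere_apply f x + b * sphere_apply g x) \<in> {f :: real ^ 'n::finite \<Rightarrow> real.
      smooth_map_on (sphere 0 1) f \<and> (\<forall>x. x \<notin> sphere 0 1 \<longrightarrow> f x = 0)}"
  using sphere_apply[of f] sphere_apply[of g]
    smooth_map_on_lincomb[of "sphere 0 1" "sphere_apply f" "sphere_apply g" a b]
  by simp

instantiation sphere_fun :: (finite) real_vector
begin

definition "0 = Abs_sphere_fun (\<lambda>_. 0)"
definition "f + g = Abs_sphere_fun (\<lambda>x. sphere_apply f x + sphere_apply g x)"
definition "f - g = Abs_sphere_fun (\<lambda>x. sphere_apply f x - sphere_apply g x)"
definition "- f = Abs_sphere_fun (\<lambda>x. - sphere_apply f x)"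
definition "c *\<^sub>R f = Abs_sphere_fun (\<lambda>x. c * sphere_apply f x)"

lemma sphere_apply_zero: "sphere_apply 0 x = 0"
  unfolding zero_sphere_fun_def by (simp add: Abs_sphere_fun_inverse smooth_map_on_zero)

lemma sphere_apply_add: "sphere_apply (f + g) x = sphere_apply f x + sphere_apply g x"
  unfolding plus_sphere_fun_def
  using sphere_fun_lincomb[of 1 f 1 g] by (simp add: Abs_sphere_fun_inverse)

lemma sphere_apply_diff: "sphere_apply (f - g) x = sphere_apply f x - sphere_apply g x"
  unfolding minus_sphere_fun_def
  using sphere_fun_lincomb[of 1 f "-1" g] by (simp add: Abs_sphere_fun_inverse)

lemma sphere_apply_uminus: "sphere_apply (- f) x = - sphere_apply f x"
  unfolding uminus_sphere_fun_def
  using sphere_fun_lincomb[of "-1" f 0 f] by (simp add: Abs_sphere_fun_inverse)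

lemma sphere_apply_scaleR: "sphere_apply (c *\<^sub>R f) x = c * sphere_apply f x"
  unfolding scaleR_sphere_fun_def
  using sphere_fun_lincomb[of c f 0 f] by (simp add: Abs_sphere_fun_inverse)

instance
  by standard
    (simp_all add: sphere_apply_inject[symmetric] fun_eq_iff sphere_apply_zero sphere_apply_add
      sphere_apply_diff sphere_apply_uminus sphere_apply_scaleR algebra_simps)

end

text \<open>The extension of a function on the sphere that is constant along rays; on a neighbourhood of
  the sphere its iterated partial derivatives carry all derivatives of the given function.\<close>

definition radial_ext :: "('n::finite) sphere_fun \<Rightarrow> real ^ 'n \<Rightarrow> real" where
  "radial_ext f y = sphere_apply f (sgn y)"

instantiation sphere_fun :: (finite) t2_space
begin

text \<open>The topology of uniform convergence of all derivatives.\<close>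

definition open_sphere_fun :: "'a sphere_fun set \<Rightarrow> bool" where
  "open_sphere_fun S \<longleftrightarrow> (\<forall>f\<in>S. \<exists>k. \<exists>\<epsilon>>0. \<forall>g.
     (\<forall>j\<le>k. \<forall>x\<in>sphere 0 1. \<forall>v. range v \<subseteq> Basis \<longrightarrow>
        \<bar>iter_deriv j (radial_ext g) x v - iter_deriv j (radial_ext f) x v\<bar> < \<epsilon>) \<longrightarrow> g \<in> S)"

instance
proof
  show "open (UNIV :: 'a sphere_fun set)"
    unfolding open_sphere_fun_def by (auto intro: exI[of _ 1])
next
  fix S T :: "'a sphere_fun set"
  assume S: "open S" and T: "open T"
  show "open (S \<inter> T)"
    unfolding open_sphere_fun_def
  proof
    fix f assume f: "f \<in> S \<inter> T"
    obtain k \<epsilon> where k: "\<epsilon> > 0" "\<And>g. (\<forall>j\<le>k. \<forall>x\<in>sphere 0 1. \<forall>v. range v \<subseteq> Basis \<longrightarrow>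
        \<bar>iter_deriv j (radial_ext g) x v - iter_deriv j (radial_ext f) x v\<bar> < \<epsilon>) \<Longrightarrow> g \<in> S"
      using S f unfolding open_sphere_fun_def by (metis IntD1)
    obtain l \<delta> where l: "\<delta> > 0" "\<And>g. (\<forall>j\<le>l. \<forall>x\<in>sphere 0 1. \<forall>v. range v \<subseteq> Basis \<longrightarrow>
        \<bar>iter_deriv j (radial_ext g) x v - iter_deriv j (radial_ext f) x v\<bar> < \<delta>) \<Longrightarrow> g \<in> T"
      using T f unfolding open_sphere_fun_def by (metis IntD2)
    show "\<exists>k. \<exists>\<epsilon>>0. \<forall>g. (\<forall>j\<le>k. \<forall>x\<in>sphere 0 1. \<forall>v. range v \<subseteq> Basis \<longrightarrow>
        \<bar>iter_deriv j (radial_ext g) x v - iter_deriv j (radial_ext f) x v\<bar> < \<epsilon>) \<longrightarrow> g \<in> S \<inter> T"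
      using k(1) l(1)
      by (intro exI[of _ "max k l"] exI[of _ "min \<epsilon> \<delta>"] conjI allI impI IntI k(2) l(2)) auto
  qed
next
  fix K :: "'a sphere_fun set set"
  assume K: "\<forall>S\<in>K. open S"
  show "open (\<Union>K)"
    unfolding open_sphere_fun_def
  proof
    fix f assume "f \<in> \<Union>K"
    then obtain S where S: "S \<in> K" "f \<in> S" by blast
    with K obtain k \<epsilon> where "\<epsilon> > 0" "\<And>g. (\<forall>j\<le>k. \<forall>x\<in>sphere 0 1. \<forall>v. range v \<subseteq> Basis \<longrightarrow>
        \<bar>iter_deriv j (radial_ext g) x v - iter_deriv j (radial_ext f) x v\<bar> < \<epsilon>) \<Longrightarrow> g \<in> S"
      unfolding open_sphere_fun_def by metis
    with S(1) show "\<exists>k. \<exists>\<epsilon>>0. \<forall>g. (\<forall>j\<le>k. \<forall>x\<in>sphere 0 1. \<forall>v. range v \<subseteq> Basis \<longrightarrow>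
        \<bar>iter_deriv j (radial_ext g) x v - iter_deriv j (radial_ext f) x v\<bar> < \<epsilon>) \<longrightarrow> g \<in> \<Union>K"
      by (intro exI[of _ k] exI[of _ \<epsilon>] conjI allI impI UnionI[of S]) auto
  qed
next
  fix f g :: "'a sphere_fun"
  assume "f \<noteq> g"
  then obtain x where x: "sphere_apply f x \<noteq> sphere_apply g x"
    by (metis sphere_apply_inject ext)
  then have xS: "x \<in> sphere 0 1" using sphere_apply[of f] sphere_apply[of g] by force
  then have sx: "sgn x = x" by (simp add: sgn_div_norm)
  define r where "r = \<bar>sphere_apply f x - sphere_apply g x\<bar> / 2"
  have r: "r > 0" using x by (simp add: r_def)
  let ?B = "\<lambda>f. {h. \<bar>sphere_apply h x - sphere_apply f x\<bar> < r}"
  have op: "open (?B f)" for f :: "'a sphere_fun"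
    unfolding open_sphere_fun_def
  proof
    fix h assume h: "h \<in> ?B f"
    let ?e = "r - \<bar>sphere_apply h x - sphere_apply f x\<bar>"
    show "\<exists>k. \<exists>\<epsilon>>0. \<forall>g. (\<forall>j\<le>k. \<forall>x\<in>sphere 0 1. \<forall>v. range v \<subseteq> Basis \<longrightarrow>
        \<bar>iter_deriv j (radial_ext g) x v - iter_deriv j (radial_ext h) x v\<bar> < \<epsilon>) \<longrightarrow> g \<in> ?B f"
    proof (intro exI[of _ "0::nat"] exI[of _ ?e] conjI allI impI)
      show "?e > 0" using h by simp
    next
      fix g :: "'a sphere_fun"
      assume *: "\<forall>j\<le>0. \<forall>x\<in>sphere 0 1. \<forall>v. range v \<subseteq> Basis \<longrightarrow>
        \<bar>iter_deriv j (radial_ext g) x v - iter_deriv j (radial_ext h) x v\<bar> < ?e"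
      obtain b :: "real ^ 'a" where "b \<in> Basis" using nonempty_Basis by blast
      then have "\<bar>radial_ext g x - radial_ext h x\<bar> < ?e"
        using *[rule_format, of 0 x "\<lambda>_. b"] xS by auto
      then show "g \<in> ?B f" by (simp add: radial_ext_def sx)
    qed
  qed
  have "?B f \<inter> ?B g = {}" unfolding r_def by (auto simp: field_simps abs_if split: if_splits)
  then show "\<exists>U V. open U \<and> open V \<and> f \<in> U \<and> g \<in> V \<and> U \<inter> V = {}"
    using op[of f] op[of g] r by (intro exI[of _ "?B f"] exI[of _ "?B g"]) auto
qed

end


section \<open>The Lorentz group and its action on the sphere\<close>

text \<open>\<open>\<real>\<^sup>1\<^sup>,\<^sup>d\<^sup>+\<^sup>1\<close> is \<open>real ^ 'n option\<close> with \<open>CARD('n) = d + 1\<close>; the index \<open>None\<close> is the time coordinate.\<close>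

definition lorentz_form :: "real ^ 'n::finite option \<Rightarrow> real" where
  "lorentz_form v = (v $ None)\<^sup>2 - (\<Sum>i\<in>UNIV. (v $ Some i)\<^sup>2)"

type_synonym 'n lorentz_mat = "real ^ 'n option ^ 'n option"

definition lorentz_group :: "('n::finite) lorentz_mat set" where
  "lorentz_group = {g. \<forall>v. lorentz_form (g *v v) = lorentz_form v}"

definition SO0 :: "('n::finite) lorentz_mat monoid" where
  "SO0 = \<lparr>carrier = connected_component_set lorentz_group (mat 1), monoid.mult = (**), one = mat 1\<rparr>"

definition block_a :: "('n::finite) lorentz_mat \<Rightarrow> real" where
  "block_a g = g $ None $ None"

definition block_b :: "('n::finite) lorentz_mat \<Rightarrow> real ^ 'n" where
  "block_b g = (\<chi> j. g $ None $ Some j)"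

definition block_c :: "('n::finite) lorentz_mat \<Rightarrow> real ^ 'n" where
  "block_c g = (\<chi> i. g $ Some i $ None)"

definition block_m :: "('n::finite) lorentz_mat \<Rightarrow> real ^ 'n ^ 'n" where
  "block_m g = (\<chi> i j. g $ Some i $ Some j)"

definition conf_factor :: "('n::finite) lorentz_mat \<Rightarrow> real ^ 'n \<Rightarrow> real" where
  "conf_factor g x = inverse (block_a g + block_b g \<bullet> x)"

definition sphere_action :: "('n::finite) lorentz_mat \<Rightarrow> real ^ 'n \<Rightarrow> real ^ 'n" where
  "sphere_action g x = inverse (block_a g + block_b g \<bullet> x) *\<^sub>R (block_c g + block_m g *v x)"

definition sigma :: "('n::finite) lorentz_mat \<Rightarrow> 'n sphere_fun \<Rightarrow> 'n sphere_fun" where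
  "sigma g f = Abs_sphere_fun (\<lambda>x. if x \<in> sphere 0 1
     then conf_factor (matrix_inv g) x * sphere_apply f (sphere_action (matrix_inv g) x) else 0)"


section \<open>The groups BMS\<close>

definition semidirect ::
  "('g \<Rightarrow> 'e \<Rightarrow> 'e) \<Rightarrow> 'g monoid \<Rightarrow> ('e::real_vector \<times> 'g) monoid" where
  "semidirect \<sigma> G = \<lparr>carrier = UNIV \<times> carrier G,
     monoid.mult = (\<lambda>(v, g) (w, h). (v + \<sigma> g w, g \<otimes>\<^bsub>G\<^esub> h)), one = (0, \<one>\<^bsub>G\<^esub>)\<rparr>"

text \<open>\<open>BMS TYPE('n)\<close> is the group for the sphere of dimension \<open>d = CARD('n) - 1\<close>. Since the identity
  component of the Lorentz group is an embedded submanifold of the space of matrices, the product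
  manifold structure is the one induced from \<open>'n sphere_fun \<times> 'n lorentz_mat\<close>.\<close>

definition BMS :: "('n::finite) itself \<Rightarrow> ('n sphere_fun \<times> 'n lorentz_mat) monoid" where
  "BMS _ = semidirect sigma SO0"

end

theory Submission
  imports Defs
begin

text \<open>Every exponential function of the group fails to be injective near \<open>0\<close>. Let \<open>R\<close> generate the
  rotations in a coordinate plane \<open>(i, j)\<close>, and let \<open>f\<^sub>n\<close> be the restriction of \<open>Re ((x\<^sub>i + \<i> x\<^sub>j)\<^sup>n)\<close> to
  the sphere. The component of \<open>exp (c f\<^sub>n, (2 \<pi> / n) R)\<close> in the space of functions is the average of
  \<open>c f\<^sub>n\<close> over the rotations by angles between \<open>0\<close> and \<open>2 \<pi> / n\<close>, which vanishes since this is a full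
  period of \<open>f\<^sub>n\<close>. So \<open>(c f\<^sub>n, (2 \<pi> / n) R)\<close> and \<open>(0, (2 \<pi> / n) R)\<close> have the same exponential, and
  both lie in a given neighbourhood of \<open>0\<close> once \<open>n\<close> is large and then \<open>c\<close> is small.\<close>

section \<open>Functions with algebraic iterated derivatives\<close>

text \<open>A class of functions of a point \<open>x \<noteq> 0\<close> and directions \<open>v 0, v 1, \<dots>\<close> that is closed under
  differentiating \<open>x\<close> in direction \<open>v k\<close>, and so contains the iterated derivatives of its members.\<close>

inductive dir_alg :: "('a::real_inner \<Rightarrow> (nat \<Rightarrow> 'a) \<Rightarrow> real) \<Rightarrow> bool" where
  const: "dir_alg (\<lambda>x v. c)"
| point: "dir_alg (\<lambda>x v. x \<bullet> b)"
| dir: "dir_alg (\<lambda>x v. v k \<bullet> b)"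
| point_dir: "dir_alg (\<lambda>x v. x \<bullet> v k)"
| dir_dir: "dir_alg (\<lambda>x v. v k \<bullet> v l)"
| inv_norm: "dir_alg (\<lambda>x v. inverse (norm x))"
| add: "dir_alg H \<Longrightarrow> dir_alg K \<Longrightarrow> dir_alg (\<lambda>x v. H x v + K x v)"
| mult: "dir_alg H \<Longrightarrow> dir_alg K \<Longrightarrow> dir_alg (\<lambda>x v. H x v * K x v)"

text \<open>The square of the norm along a line is a quadratic polynomial in \<open>t\<close>,
  positive at \<open>t = 0\<close>, so one-variable calculus applies. The derivative is written with
  factors \<open>inverse (norm x)\<close> so that it visibly stays in the class
  \<open>dir_alg\<close>.\<close>

lemma inverse_norm_line_derivative:
  fixes x u :: "'a::real_inner"
  assumes "x \<noteq> 0"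
  shows "((\<lambda>t. inverse (norm (x + t *\<^sub>R u))) has_real_derivative
    - (x \<bullet> u) * (inverse (norm x) * (inverse (norm x) * inverse (norm x)))) (at 0)"
proof -
  have norm_eq: "norm (x + t *\<^sub>R u) = sqrt (x \<bullet> x + 2 * t * (x \<bullet> u) + t\<^sup>2 * (u \<bullet> u))" for t
    by (simp add: norm_eq_sqrt_inner inner_simps inner_commute power2_eq_square algebra_simps)
  have "((\<lambda>t. inverse (sqrt (q + 2 * t * p + t\<^sup>2 * r))) has_real_derivative
      - p * (inverse (sqrt q) * (inverse (sqrt q) * inverse (sqrt q)))) (at 0)"
    if "q > 0" for p q r :: real
    using that by (auto intro!: derivative_eq_intros simp: divide_simps power2_eq_square)
  from this[of "x \<bullet> x" "x \<bullet> u" "u \<bullet> u"] show ?thesis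
    unfolding norm_eq using assms by (simp add: norm_eq_sqrt_inner)
qed

text \<open>Structural induction. Moving the point leaves the directions fixed, so
  \<open>dir\<close> and \<open>dir_dir\<close> have derivative zero; differentiating
  \<open>point\<close> or \<open>point_dir\<close> replaces \<open>x\<close> by \<open>v k\<close>,
  and sums and products follow the usual rules.\<close>

lemma dir_alg_derivative:
  assumes "dir_alg H"
  shows "\<exists>H'. dir_alg H' \<and> (\<forall>x v. x \<noteq> 0 \<longrightarrow>
    ((\<lambda>t. H (x + t *\<^sub>R v k) v) has_real_derivative H' x v) (at 0))"
  using assms
proof induction
  case (const c)
  show ?case by (rule exI[of _ "\<lambda>x v. 0"]) (auto intro: dir_alg.const)
next
  case (point b)
  show ?case
    by (rule exI[of _ "\<lambda>x v. v k \<bullet> b"])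
      (auto intro!: dir_alg.dir derivative_eq_intros simp: inner_simps)
next
  case (dir l b)
  show ?case by (rule exI[of _ "\<lambda>x v. 0"]) (auto intro: dir_alg.const)
next
  case (point_dir l)
  show ?case
    by (rule exI[of _ "\<lambda>x v. v k \<bullet> v l"])
      (auto intro!: dir_alg.dir_dir derivative_eq_intros simp: inner_simps)
next
  case (dir_dir l m)
  show ?case by (rule exI[of _ "\<lambda>x v. 0"]) (auto intro: dir_alg.const)
next
  case inv_norm
  \<comment> \<open>The class is closed under sums and products, so the minus sign enters as the
    constant factor \<open>-1\<close>.\<close>
  have "dir_alg (\<lambda>x v. (-1 * (x \<bullet> v k)) *
      (inverse (norm x) * (inverse (norm x) * inverse (norm x))))"
    by (intro dir_alg.intros)
  then show ?case
    using inverse_norm_line_derivative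
    by (intro exI[of _ "\<lambda>x v. (-1 * (x \<bullet> v k)) *
      (inverse (norm x) * (inverse (norm x) * inverse (norm x)))"]) auto
next
  case (add H K)
  then obtain H' K' where "dir_alg H'" "dir_alg K'"
    and d: "\<And>x v. x \<noteq> 0 \<Longrightarrow> ((\<lambda>t. H (x + t *\<^sub>R v k) v) has_real_derivative H' x v) (at 0)"
      "\<And>x v. x \<noteq> 0 \<Longrightarrow> ((\<lambda>t. K (x + t *\<^sub>R v k) v) has_real_derivative K' x v) (at 0)"
    by metis
  then show ?case
    by (intro exI[of _ "\<lambda>x v. H' x v + K' x v"]) (auto intro!: dir_alg.add DERIV_add)
next
  case (mult H K)
  then obtain H' K' where "dir_alg H'" "dir_alg K'"
    and d: "\<And>x v. x \<noteq> 0 \<Longrightarrow> ((\<lambda>t. H (x + t *\<^sub>R v k) v) has_real_derivative H' x v) (at 0)"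
      "\<And>x v. x \<noteq> 0 \<Longrightarrow> ((\<lambda>t. K (x + t *\<^sub>R v k) v) has_real_derivative K' x v) (at 0)"
    by metis
  with mult(1,2) show ?case
    by (intro exI[of _ "\<lambda>x v. H' x v * K x v + K' x v * H x v"])
      (auto intro!: dir_alg.add dir_alg.mult DERIV_mult[where x = "0::real", simplified]
        derivative_eq_intros)
qed

section \<open>Directional derivatives as derivatives along lines\<close>

lemma has_dir_deriv_real_iff:
  "has_dir_deriv f x v D \<longleftrightarrow> ((\<lambda>t. f (x + t *\<^sub>R v)) has_real_derivative D) (at 0)"
  by (simp add: has_dir_deriv_def DERIV_def divide_inverse mult.commute)

lemma has_dir_deriv_vector_iff:
  fixes f :: "'a::real_vector \<Rightarrow> 'b::real_normed_vector"
  shows "has_dir_deriv f x v D \<longleftrightarrow> ((\<lambda>t. f (x + t *\<^sub>R v)) has_vector_derivative D) (at 0)"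
proof -
  have eq: "norm ((f (x + t *\<^sub>R v) - f x) /\<^sub>R t - D) = norm (f (x + t *\<^sub>R v) - f x - t *\<^sub>R D) / norm t"
    if "t \<noteq> 0" for t :: real
  proof -
    have "(f (x + t *\<^sub>R v) - f x) /\<^sub>R t - D = (f (x + t *\<^sub>R v) - f x - t *\<^sub>R D) /\<^sub>R t"
      using that by (simp add: scaleR_right_diff_distrib)
    then show ?thesis by (simp add: divide_inverse mult.commute)
  qed
  have "has_dir_deriv f x v D \<longleftrightarrow>
      ((\<lambda>t. norm ((f (x + t *\<^sub>R v) - f x) /\<^sub>R t - D)) \<longlongrightarrow> 0) (at 0)"
    unfolding has_dir_deriv_def by (simp add: tendsto_norm_zero_iff LIM_zero_iff)
  also have "\<dots> \<longleftrightarrow>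
      ((\<lambda>t. norm (f (x + t *\<^sub>R v) - f x - t *\<^sub>R D) / norm t) \<longlongrightarrow> 0) (at 0)"
    by (intro filterlim_cong refl eventually_at_filter[THEN iffD2] always_eventually) (auto simp: eq)
  finally show ?thesis
    by (simp add: has_vector_derivative_def has_derivative_at bounded_linear_scaleR_left)
qed

section \<open>Continuity and boundedness of algebraic functions\<close>

lemma continuous_on_snd_apply:
  "continuous_on S (\<lambda>p :: 'a::topological_space \<times> ('i \<Rightarrow> 'b::topological_space). snd p k)"
proof -
  have "continuous_on S ((\<lambda>v. v k) \<circ> snd)"
    by (intro continuous_on_compose continuous_on_snd continuous_on_id
        continuous_on_subset[OF continuous_on_product_coordinates]) auto
  then show ?thesis by (simp add: o_def)
qed

lemma continuous_on_dir_alg: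
  assumes "dir_alg H"
  shows "continuous_on ((- {0}) \<times> UNIV) (\<lambda>(x, v). H x v)"
  unfolding case_prod_beta using assms
proof induction
  case inv_norm
  show ?case by (intro continuous_intros) auto
next
  case (add H K)
  then show ?case by (intro continuous_on_add)
next
  case (mult H K)
  then show ?case by (intro continuous_on_mult)
qed (intro continuous_on_inner continuous_on_const
    continuous_on_fst continuous_on_id continuous_on_snd_apply)+

text \<open>Cauchy-Schwarz bounds every generator, since points and basis directions have norm 1.
  This makes the suprema finite that measure closeness in the topology of
  \<open>sphere_fun\<close>.\<close>

lemma dir_alg_bounded:
  fixes H :: "'a::euclidean_space \<Rightarrow> (nat \<Rightarrow> 'a) \<Rightarrow> real"
  assumes "dir_alg H"
  shows "\<exists>B. \<forall>x\<in>sphere 0 1. \<forall>v. range v \<subseteq> Basis \<longrightarrow> \<bar>H x v\<bar> \<le> B"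
  using assms
proof induction
  case (point b)
  show ?case
    by (rule exI[of _ "norm b"]) (auto intro: order_trans[OF Cauchy_Schwarz_ineq2])
next
  case (dir k b)
  show ?case
  proof (intro exI[of _ "norm b"] ballI allI impI)
    fix v :: "nat \<Rightarrow> 'a" assume "range v \<subseteq> Basis"
    then have "norm (v k) = 1" by (simp add: range_subsetD)
    then show "\<bar>v k \<bullet> b\<bar> \<le> norm b" using Cauchy_Schwarz_ineq2[of "v k" b] by simp
  qed
next
  case (point_dir k)
  show ?case
  proof (intro exI[of _ 1] ballI allI impI)
    fix x :: 'a and v :: "nat \<Rightarrow> 'a" assume "x \<in> sphere 0 1" "range v \<subseteq> Basis"
    then have "norm x = 1" "norm (v k) = 1" by (simp_all add: range_subsetD)
    then show "\<bar>x \<bullet> v k\<bar> \<le> 1" using Cauchy_Schwarz_ineq2[of x "v k"] by simp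
  qed
next
  case (dir_dir k l)
  show ?case
  proof (intro exI[of _ 1] ballI allI impI)
    fix v :: "nat \<Rightarrow> 'a" assume "range v \<subseteq> Basis"
    then have "norm (v k) = 1" "norm (v l) = 1" by (simp_all add: range_subsetD)
    then show "\<bar>v k \<bullet> v l\<bar> \<le> 1" using Cauchy_Schwarz_ineq2[of "v k" "v l"] by simp
  qed
next
  case (add H K)
  then obtain B C where
    "\<forall>x\<in>sphere 0 1. \<forall>v. range v \<subseteq> Basis \<longrightarrow> \<bar>H x v\<bar> \<le> B"
    "\<forall>x\<in>sphere 0 1. \<forall>v. range v \<subseteq> Basis \<longrightarrow> \<bar>K x v\<bar> \<le> C" by blast
  then have "\<bar>H x v + K x v\<bar> \<le> B + C" if "x \<in> sphere 0 1" "range v \<subseteq> Basis" for x v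
    using that by (meson abs_triangle_ineq add_mono order_trans)
  then show ?case by blast
next
  case (mult H K)
  then obtain B C where
    "\<forall>x\<in>sphere 0 1. \<forall>v. range v \<subseteq> Basis \<longrightarrow> \<bar>H x v\<bar> \<le> B"
    "\<forall>x\<in>sphere 0 1. \<forall>v. range v \<subseteq> Basis \<longrightarrow> \<bar>K x v\<bar> \<le> C" by blast
  then have "\<bar>H x v * K x v\<bar> \<le> B * C" if "x \<in> sphere 0 1" "range v \<subseteq> Basis" for x v
    using that unfolding abs_mult by (intro mult_mono') auto
  then show ?case by blast
qed auto

text \<open>Induction on \<open>k\<close>: the complement of \<open>0\<close> is open, so agreement
  there with a member of the class passes to directional derivatives, which are again members by
  \<open>dir_alg_derivative\<close>.\<close>

lemma dir_alg_iter_deriv: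
  fixes g :: "'a::real_inner \<Rightarrow> real"
  assumes "dir_alg G" "\<And>x v. x \<noteq> 0 \<Longrightarrow> g x = G x v"
  shows "\<exists>H. dir_alg H \<and> (\<forall>x v. x \<noteq> 0 \<longrightarrow> iter_deriv k g x v = H x v)"
    and "x \<noteq> 0 \<Longrightarrow> \<exists>D. has_dir_deriv (\<lambda>y. iter_deriv k g y v) x (v k) D"
proof -
  have step: "\<exists>H'. dir_alg H' \<and>
      (\<forall>x v. x \<noteq> 0 \<longrightarrow> has_dir_deriv (\<lambda>y. iter_deriv k g y v) x (v k) (H' x v))"
    if IH: "dir_alg H" "\<forall>x v. x \<noteq> 0 \<longrightarrow> iter_deriv k g x v = H x v" for k H
  proof -
    obtain H' where H': "dir_alg H'" "\<And>x v. x \<noteq> 0 \<Longrightarrow>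
        ((\<lambda>t. H (x + t *\<^sub>R v k) v) has_real_derivative H' x v) (at 0)"
      using dir_alg_derivative[OF IH(1)] by metis
    have "has_dir_deriv (\<lambda>y. iter_deriv k g y v) x (v k) (H' x v)" if x: "x \<noteq> 0" for x v
    proof (rule has_dir_deriv_cong[of "- {0}"])
      show "has_dir_deriv (\<lambda>y. H y v) x (v k) (H' x v)"
        using H'(2)[OF x] by (simp add: has_dir_deriv_real_iff)
    qed (use x IH(2) in auto)
    with H'(1) show ?thesis by blast
  qed
  show all: "\<exists>H. dir_alg H \<and> (\<forall>x v. x \<noteq> 0 \<longrightarrow> iter_deriv k g x v = H x v)" for k
  proof (induction k)
    case 0
    show ?case using assms by (intro exI[of _ G]) auto
  next
    case (Suc k)
    then obtain H where "dir_alg H" "\<forall>x v. x \<noteq> 0 \<longrightarrow> iter_deriv k g x v = H x v" by blast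
    from step[OF this] obtain H' where "dir_alg H'"
      "\<And>x v. x \<noteq> 0 \<Longrightarrow> has_dir_deriv (\<lambda>y. iter_deriv k g y v) x (v k) (H' x v)" by blast
    then show ?case by (intro exI[of _ H']) (auto intro: dir_deriv_eqI)
  qed
  show "x \<noteq> 0 \<Longrightarrow> \<exists>D. has_dir_deriv (\<lambda>y. iter_deriv k g y v) x (v k) D"
    using all[of k] step[of _ k] by blast
qed

lemma dir_alg_bastiani_smooth:
  fixes g :: "'a::real_inner \<Rightarrow> real"
  assumes "dir_alg G" "\<And>x v. x \<noteq> 0 \<Longrightarrow> g x = G x v"
  shows "bastiani_smooth (- {0}) g"
  unfolding bastiani_smooth_def
proof (intro conjI allI ballI)
  fix k
  obtain H where H: "dir_alg H" "\<And>x v. x \<noteq> 0 \<Longrightarrow> iter_deriv k g x v = H x v"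
    using dir_alg_iter_deriv(1)[OF assms] by metis
  show "continuous_on ((- {0}) \<times> UNIV) (\<lambda>(x, v). iter_deriv k g x v)"
    using continuous_on_dir_alg[OF H(1)]
    by (rule continuous_on_cong[THEN iffD1, rotated -1]) (use H(2) in fastforce)+
qed (use dir_alg_iter_deriv(2)[OF assms] in auto)


section \<open>Continuity in the space of smooth functions on the sphere\<close>

lemma sphere_apply_outside: "x \<notin> sphere 0 1 \<Longrightarrow> sphere_apply f x = 0"
  using sphere_apply[of f] by auto

text \<open>Point evaluation is continuous: at a point of the sphere, the order 0 condition of the
  topology already controls the value, because \<open>sgn x = x\<close> there.\<close>

lemma tendsto_sphere_apply:
  fixes F :: "'b \<Rightarrow> 'n::finite sphere_fun"
  assumes "(F \<longlongrightarrow> f) net"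
  shows "((\<lambda>t. sphere_apply (F t) x) \<longlongrightarrow> sphere_apply f x) net"
proof (cases "x \<in> sphere 0 1")
  case True
  then have sx: "sgn x = x" by (simp add: sgn_div_norm)
  show ?thesis
    unfolding tendsto_iff dist_real_def
  proof (intro allI impI)
    fix r :: real assume "r > 0"
    let ?B = "{h. \<bar>sphere_apply h x - sphere_apply f x\<bar> < r}"
    have "open ?B"
      unfolding open_sphere_fun_def
    proof
      fix h assume h: "h \<in> ?B"
      let ?e = "r - \<bar>sphere_apply h x - sphere_apply f x\<bar>"
      show "\<exists>k. \<exists>\<epsilon>>0. \<forall>g. (\<forall>j\<le>k. \<forall>x\<in>sphere 0 1. \<forall>v. range v \<subseteq> Basis \<longrightarrow>
          \<bar>iter_deriv j (radial_ext g) x v - iter_deriv j (radial_ext h) x v\<bar> < \<epsilon>) \<longrightarrow> g \<in> ?B"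
      proof (intro exI[of _ "0::nat"] exI[of _ ?e] conjI allI impI)
        show "?e > 0" using h by simp
      next
        fix g :: "'n sphere_fun"
        assume *: "\<forall>j\<le>0. \<forall>x\<in>sphere 0 1. \<forall>v. range v \<subseteq> Basis \<longrightarrow>
          \<bar>iter_deriv j (radial_ext g) x v - iter_deriv j (radial_ext h) x v\<bar> < ?e"
        \<comment> \<open>Any constant sequence of basis vectors will serve to instantiate the
          directions in the order 0 condition.\<close>
        obtain b :: "real ^ 'n" where "b \<in> Basis" using nonempty_Basis by blast
        then have "\<bar>radial_ext g x - radial_ext h x\<bar> < ?e"
          using *[rule_format, of 0 x "\<lambda>_. b"] True by auto
        then show "g \<in> ?B" by (simp add: radial_ext_def sx)
      qed
    qed
    moreover have "f \<in> ?B" using \<open>r > 0\<close> by simp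
    ultimately have "\<forall>\<^sub>F t in net. F t \<in> ?B" using assms by (auto simp: tendsto_def)
    then show "\<forall>\<^sub>F t in net. \<bar>sphere_apply (F t) x - sphere_apply f x\<bar> < r" by simp
  qed
qed (simp add: sphere_apply_outside)

text \<open>For each order, the derivatives of \<open>r *\<^sub>R f\<close> are \<open>r\<close>
  times those of \<open>f\<close>, which \<open>dir_alg_bounded\<close> bounds on the sphere. Hence
  \<open>r \<mapsto> r *\<^sub>R f\<close> is Lipschitz for every condition that defines the
  topology.\<close>

lemma continuous_on_scaleR_sphere_fun:
  fixes f :: "'n::finite sphere_fun"
  assumes G: "dir_alg G" "\<And>x v. x \<noteq> 0 \<Longrightarrow> radial_ext f x = G x v"
  shows "continuous_on UNIV (\<lambda>r::real. r *\<^sub>R f)"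
proof -
  let ?N = "\<lambda>j x v. iter_deriv j (radial_ext f) x v"
  \<comment> \<open>Scaling is the linear combination whose second coefficient is 0.\<close>
  have scale: "iter_deriv j (radial_ext (r *\<^sub>R f)) x v = r * ?N j x v" if "x \<noteq> 0" for j r x v
    using iter_deriv_lincomb(1)[OF dir_alg_bastiani_smooth dir_alg_bastiani_smooth,
        OF G G, of x j r 0 v] that
    by (simp add: radial_ext_def[abs_def] sphere_apply_scaleR)
  have "\<exists>B. \<forall>x\<in>sphere 0 1. \<forall>v. range v \<subseteq> Basis \<longrightarrow> \<bar>?N j x v\<bar> \<le> B" for j
  proof -
    obtain H where H: "dir_alg H" "\<And>x v. x \<noteq> 0 \<Longrightarrow> ?N j x v = H x v"
      using dir_alg_iter_deriv(1)[OF G] by metis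
    obtain B where "\<forall>x\<in>sphere 0 1. \<forall>v. range v \<subseteq> Basis \<longrightarrow> \<bar>H x v\<bar> \<le> B"
      using dir_alg_bounded[OF H(1)] by blast
    then show ?thesis using H(2) by (metis mem_sphere_0 norm_zero zero_neq_one)
  qed
  then obtain B where B: "\<And>j x v. x \<in> sphere 0 1 \<Longrightarrow> range v \<subseteq> Basis \<Longrightarrow> \<bar>?N j x v\<bar> \<le> B j"
    by metis
  have "open ((\<lambda>r::real. r *\<^sub>R f) -` S)" if S: "open S" for S
    unfolding open_dist
  proof
    fix r assume "r \<in> (\<lambda>r. r *\<^sub>R f) -` S"
    then obtain k \<epsilon> where k: "\<epsilon> > 0" "\<And>g. (\<forall>j\<le>k. \<forall>x\<in>sphere 0 1. \<forall>v. range v \<subseteq> Basis \<longrightarrow>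
        \<bar>iter_deriv j (radial_ext g) x v - iter_deriv j (radial_ext (r *\<^sub>R f)) x v\<bar> < \<epsilon>) \<Longrightarrow> g \<in> S"
      using S unfolding open_sphere_fun_def by (metis vimageD)
    \<comment> \<open>The sum dominates the bounds of all orders up to \<open>k\<close> at once;
      adding 1 makes division by \<open>M\<close> safe.\<close>
    define M where "M = (\<Sum>j\<le>k. \<bar>B j\<bar>) + 1"
    have M: "M > 0" unfolding M_def by (simp add: add_nonneg_pos sum_nonneg)
    have BM: "\<bar>?N j x v\<bar> \<le> M" if "j \<le> k" "x \<in> sphere 0 1" "range v \<subseteq> Basis" for j x v
    proof -
      have "\<bar>B j\<bar> \<le> (\<Sum>j\<le>k. \<bar>B j\<bar>)" using that(1) by (intro member_le_sum) auto
      with B[OF that(2,3), of j] show ?thesis unfolding M_def by linarith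
    qed
    show "\<exists>e>0. \<forall>s. dist s r < e \<longrightarrow> s \<in> (\<lambda>r. r *\<^sub>R f) -` S"
    proof (intro exI[of _ "\<epsilon> / M"] conjI allI impI vimageI2 k(2) ballI)
      fix s j and x :: "real ^ 'n" and v :: "nat \<Rightarrow> real ^ 'n"
      assume s: "dist s r < \<epsilon> / M" and *: "j \<le> k" "x \<in> sphere 0 1" "range v \<subseteq> Basis"
      have "x \<noteq> 0" using *(2) by auto
      then have "\<bar>iter_deriv j (radial_ext (s *\<^sub>R f)) x v - iter_deriv j (radial_ext (r *\<^sub>R f)) x v\<bar>
          = \<bar>s - r\<bar> * \<bar>?N j x v\<bar>"
        by (simp add: scale abs_mult[symmetric] left_diff_distrib)
      also have "\<dots> \<le> \<bar>s - r\<bar> * M" using BM[OF *] by (intro mult_left_mono) auto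
      also have "\<dots> < \<epsilon>" using s M by (simp add: dist_real_def pos_less_divide_eq)
      finally show "\<bar>iter_deriv j (radial_ext (s *\<^sub>R f)) x v
          - iter_deriv j (radial_ext (r *\<^sub>R f)) x v\<bar> < \<epsilon>" .
    qed (use k(1) M in simp)
  qed
  then show ?thesis by (simp add: continuous_on_open_vimage)
qed


section \<open>Rotations in a coordinate plane\<close>

text \<open>For \<open>i \<noteq> j\<close> this is the infinitesimal rotation that sends the
  \<open>i\<close>-th basis vector to the \<open>j\<close>-th and the \<open>j\<close>-th to minus
  the \<open>i\<close>-th.\<close>

definition rot_gen :: "'m \<Rightarrow> 'm \<Rightarrow> real ^ 'm::finite ^ 'm" where
  "rot_gen i j = (\<chi> a b. if a = j \<and> b = i then 1 else if a = i \<and> b = j then -1 else 0)"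

text \<open>Rodrigues' formula: for \<open>i \<noteq> j\<close> the generator satisfies
  \<open>A ** A ** A = - A\<close>, and its exponential series sums to this closed form.\<close>

definition rot :: "'m \<Rightarrow> 'm \<Rightarrow> real \<Rightarrow> real ^ 'm::finite ^ 'm" where
  "rot i j \<theta> = mat 1 + sin \<theta> *\<^sub>R rot_gen i j + (1 - cos \<theta>) *\<^sub>R (rot_gen i j ** rot_gen i j)"

lemma rot_gen_vector:
  assumes "i \<noteq> j"
  shows "(rot_gen i j *v x) $ a = (if a = j then x $ i else if a = i then - x $ j else 0)"
proof -
  have "(if a = j \<and> b = i then 1 else if a = i \<and> b = j then -1 else 0) * x $ b =
      (if b = i then if a = j then x $ i else 0 else 0)
        + (if b = j then if a = i then - x $ j else 0 else 0)" for b
    using assms by auto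
  then have "(rot_gen i j *v x) $ a =
      (\<Sum>b\<in>UNIV. (if b = i then if a = j then x $ i else 0 else 0)
        + (if b = j then if a = i then - x $ j else 0 else 0))"
    unfolding matrix_vector_mult_def rot_gen_def by simp
  then show ?thesis using assms by (simp add: sum.distrib)
qed

lemma rot_vector:
  assumes "i \<noteq> j"
  shows "(rot i j \<theta> *v x) $ a = (if a = i then cos \<theta> * x $ i - sin \<theta> * x $ j
    else if a = j then sin \<theta> * x $ i + cos \<theta> * x $ j else x $ a)"
  using assms
  by (simp add: rot_def matrix_vector_mult_add_rdistrib scaleR_matrix_vector_assoc[symmetric]
      matrix_vector_mul_assoc[symmetric] rot_gen_vector algebra_simps)

lemma rot_zero: "rot i j 0 = mat 1"
  by (simp add: rot_def)

lemma rot_mult: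
  assumes "i \<noteq> j"
  shows "rot i j s ** rot i j t = rot i j (s + t)"
  using assms
  by (simp add: matrix_eq vec_eq_iff matrix_vector_mul_assoc[symmetric] rot_vector
      cos_add sin_add algebra_simps)

lemma matrix_inv_rot:
  assumes "i \<noteq> j"
  shows "matrix_inv (rot i j \<theta>) = rot i j (- \<theta>)"
proof -
  \<comment> \<open>\<open>matrix_inv\<close> is a choice among two-sided inverses. It is pinned
    down by multiplying this right inverse equation by the known inverse from the left.\<close>
  have "rot i j \<theta> ** matrix_inv (rot i j \<theta>) = mat 1"
    unfolding matrix_inv_def
    by (rule someI2[of _ "rot i j (- \<theta>)"]) (simp_all add: rot_mult[OF assms] rot_zero)
  then have "rot i j (- \<theta>) ** (rot i j \<theta> ** matrix_inv (rot i j \<theta>)) = rot i j (- \<theta>)"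
    by simp
  then show ?thesis by (simp add: matrix_mul_assoc rot_mult[OF assms] rot_zero)
qed

text \<open>The right-hand side is the derivative of \<open>rot i j\<close> at the angle, so this is
  the differential equation of the rotation group.\<close>

lemma rot_gen_rot:
  assumes "i \<noteq> j"
  shows "rot_gen i j ** rot i j \<theta> = cos \<theta> *\<^sub>R rot_gen i j + sin \<theta> *\<^sub>R (rot_gen i j ** rot_gen i j)"
  using assms
  by (auto simp: matrix_eq vec_eq_iff matrix_vector_mul_assoc[symmetric] rot_vector rot_gen_vector
      matrix_vector_mult_add_rdistrib scaleR_matrix_vector_assoc[symmetric])

text \<open>Stated for sums of squares so that it serves both the Euclidean norm and the spatial
  part of the Lorentz form.\<close>

lemma sum_squares_rot:
  assumes "i \<noteq> j"
  shows "(\<Sum>a\<in>UNIV. ((rot i j \<theta> *v x) $ a)\<^sup>2) = (\<Sum>a\<in>UNIV. (x $ a)\<^sup>2)"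
proof -
  have split: "(\<Sum>a\<in>UNIV. f a) = f i + (f j + (\<Sum>a\<in>UNIV - {i} - {j}. f a))" for f :: "_ \<Rightarrow> real"
    using assms by (subst sum.remove[of _ i], simp_all, subst sum.remove[of _ j]) auto
  have "(cos \<theta> * x $ i - sin \<theta> * x $ j)\<^sup>2 + (sin \<theta> * x $ i + cos \<theta> * x $ j)\<^sup>2
      = ((sin \<theta>)\<^sup>2 + (cos \<theta>)\<^sup>2) * ((x $ i)\<^sup>2 + (x $ j)\<^sup>2)"
    by algebra
  then have "(cos \<theta> * x $ i - sin \<theta> * x $ j)\<^sup>2 + (sin \<theta> * x $ i + cos \<theta> * x $ j)\<^sup>2
      = (x $ i)\<^sup>2 + (x $ j)\<^sup>2"
    by simp
  then show ?thesis unfolding split rot_vector[OF assms] using assms by simp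
qed

lemma norm_rot: "i \<noteq> j \<Longrightarrow> norm (rot i j \<theta> *v x) = norm x"
  using sum_squares_rot[of i j \<theta> x] by (simp add: norm_vec_def L2_set_def)

lemma rot_Some_vector:
  assumes "i \<noteq> j"
  shows "(rot (Some i) (Some j) \<theta> *v v) $ None = v $ None"
    and "(rot (Some i) (Some j) \<theta> *v v) $ Some a = (rot i j \<theta> *v (\<chi> k. v $ Some k)) $ a"
  using assms by (simp_all add: rot_vector)

lemma rot_in_lorentz_group:
  assumes "i \<noteq> j"
  shows "rot (Some i) (Some j) \<theta> \<in> lorentz_group"
  using sum_squares_rot[OF assms, of \<theta>]
  by (simp add: lorentz_group_def lorentz_form_def rot_Some_vector[OF assms])

lemma continuous_on_rot: "continuous_on UNIV (rot i j)"
  unfolding rot_def[abs_def] by (intro continuous_intros)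

text \<open>The rotations of all angles form a connected subset of the Lorentz group, the image of
  the real line, and this subset contains the identity.\<close>

lemma rot_in_SO0:
  assumes "i \<noteq> j"
  shows "rot (Some i) (Some j) \<theta> \<in> carrier SO0"
proof -
  have "connected (range (rot (Some i) (Some j)))"
    by (intro connected_continuous_image continuous_on_rot) simp
  moreover have "mat 1 \<in> range (rot (Some i) (Some j))" by (metis rangeI rot_zero)
  ultimately show ?thesis
    using rot_in_lorentz_group[OF assms]
    by (auto simp: SO0_def connected_component_def intro!: exI[of _ "range (rot (Some i) (Some j))"])
qed

lemma rot_entry:
  assumes "i \<noteq> j"
  shows "rot i j \<theta> $ a $ b = (if a = i then if b = i then cos \<theta> else if b = j then - sin \<theta> else 0
    else if a = j then if b = i then sin \<theta> else if b = j then cos \<theta> else 0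
    else if a = b then 1 else 0)"
proof -
  have "rot i j \<theta> $ a $ b = (rot i j \<theta> *v axis b 1) $ a"
    by (simp add: matrix_vector_mult_basis column_def)
  also have "\<dots> = (if a = i then if b = i then cos \<theta> else if b = j then - sin \<theta> else 0
    else if a = j then if b = i then sin \<theta> else if b = j then cos \<theta> else 0
    else if a = b then 1 else 0)"
    unfolding rot_vector[OF assms] using assms by (auto simp: axis_def)
  finally show ?thesis .
qed

lemma blocks_rot:
  assumes "i \<noteq> j"
  shows "block_a (rot (Some i) (Some j) \<theta>) = 1" "block_b (rot (Some i) (Some j) \<theta>) = 0"
    "block_c (rot (Some i) (Some j) \<theta>) = 0" "block_m (rot (Some i) (Some j) \<theta>) = rot i j \<theta>"
  using assms
  by (simp_all add: block_a_def block_b_def block_c_def block_m_def vec_eq_iff rot_entry)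

section \<open>Differentiation and uniqueness of one-parameter groups of matrices\<close>

lemma bounded_bilinear_matrix_mult:
  "bounded_bilinear ((**) :: real ^ 'm::finite ^ 'm \<Rightarrow> real ^ 'm ^ 'm \<Rightarrow> real ^ 'm ^ 'm)"
  unfolding bilinear_conv_bounded_bilinear[symmetric] bilinear_def
  by (auto intro!: linearI simp: vec_eq_iff matrix_matrix_mult_def sum_distrib_left
      sum.distrib distrib_left distrib_right mult.left_commute mult.assoc)

lemma has_vector_derivative_rot:
  assumes "i \<noteq> j"
  shows "((\<lambda>t. rot i j (\<theta> * t)) has_vector_derivative \<theta> *\<^sub>R (rot_gen i j ** rot i j (\<theta> * t))) (at t)"
  unfolding rot_gen_rot[OF assms] unfolding rot_def
  by (auto intro!: derivative_eq_intros simp: algebra_simps)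

text \<open>The group law carries the derivative at 0 to every time. The product of
  \<open>g t\<close> with the inverse rotation then has derivative zero, so it stays at its initial
  value, the identity.\<close>

lemma one_parameter_group_rot:
  fixes g :: "real \<Rightarrow> real ^ 'm::finite ^ 'm"
  assumes "i \<noteq> j" and add: "\<And>s t. g (s + t) = g s ** g t" and "g 0 = mat 1"
    and d: "(g has_vector_derivative \<theta> *\<^sub>R rot_gen i j) (at 0)"
  shows "g t = rot i j (\<theta> * t)"
proof -
  let ?A = "rot_gen i j"
  interpret mm: bounded_bilinear "(**) :: real ^ 'm ^ 'm \<Rightarrow> real ^ 'm ^ 'm \<Rightarrow> real ^ 'm ^ 'm"
    by (rule bounded_bilinear_matrix_mult)
  have dg: "(g has_vector_derivative g s ** (\<theta> *\<^sub>R ?A)) (at s)" for s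
  proof -
    \<comment> \<open>Here \<open>g t\<close> is differentiated at \<open>s\<close> through the
      factorization \<open>g t = g s ** g (t - s)\<close>.\<close>
    have "((\<lambda>t. t - s) has_vector_derivative 1) (at s)"
      by (auto intro!: derivative_eq_intros)
    from vector_diff_chain_at[OF this, of g "\<theta> *\<^sub>R ?A"] d
    have "((\<lambda>t. g (t - s)) has_vector_derivative \<theta> *\<^sub>R ?A) (at s)" by (simp add: o_def)
    from bounded_linear.has_vector_derivative[OF mm.bounded_linear_right this, of "g s"]
    show ?thesis by (simp add: add[symmetric])
  qed
  define h where "h t = g t ** rot i j (- \<theta> * t)" for t
  have "(h has_vector_derivative 0) (at t)" for t
  proof -
    have "(h has_vector_derivative (g t ** (- \<theta> *\<^sub>R (?A ** rot i j (- \<theta> * t)))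
        + (g t ** (\<theta> *\<^sub>R ?A)) ** rot i j (- \<theta> * t))) (at t)"
      unfolding h_def[abs_def]
      by (rule mm.has_vector_derivative[OF dg has_vector_derivative_rot[OF assms(1)]])
    then show ?thesis
      by (simp add: mm.scaleR_left mm.scaleR_right mm.minus_right matrix_mul_assoc)
  qed
  then obtain C where "\<And>t. h t = C"
    using has_vector_derivative_zero_constant[of UNIV h] by (auto simp: has_vector_derivative_at_within)
  then have "h t = h 0" by simp
  then have "h t ** rot i j (\<theta> * t) = rot i j (\<theta> * t)"
    by (simp add: h_def assms(3) rot_zero)
  then show ?thesis
    by (simp add: h_def matrix_mul_assoc[symmetric] rot_mult[OF assms(1)] rot_zero)
qed


section \<open>The action of rotations on functions\<close>

text \<open>Since \<open>L (x + t *\<^sub>R v) = L x + t *\<^sub>R L v\<close>, both sides take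
  limits of the same difference quotients; the identity holds whether or not the limits
  exist.\<close>

lemma iter_deriv_compose_linear:
  fixes L :: "'a::real_vector \<Rightarrow> 'b::real_vector" and F :: "'b \<Rightarrow> 'c::{real_vector,t2_space}"
  assumes "linear L"
  shows "iter_deriv k (\<lambda>x. F (L x)) x v = iter_deriv k F (L x) (\<lambda>l. L (v l))"
  by (induction k arbitrary: x)
    (simp_all add: dir_deriv_def linear_add[OF assms] linear_scale[OF assms])

lemma bastiani_smooth_compose_linear:
  fixes L :: "'a::real_normed_vector \<Rightarrow> 'b::real_normed_vector"
    and F :: "'b \<Rightarrow> 'c::{real_vector,t2_space}"
  assumes "bounded_linear L" "bastiani_smooth U F"
  shows "bastiani_smooth (L -` U) (\<lambda>x. F (L x))"
proof -
  have lin: "linear L" using assms(1) by (rule bounded_linear.linear)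
  have cont: "continuous_on S L" for S using assms(1) by (rule linear_continuous_on)
  show ?thesis
    unfolding bastiani_smooth_def iter_deriv_compose_linear[OF lin]
  proof (intro conjI allI ballI)
    show "open (L -` U)"
      using assms(2) cont by (intro open_vimage) (auto simp: bastiani_smooth_def)
  next
    fix k x v assume "x \<in> L -` U"
    then obtain D where "has_dir_deriv (\<lambda>y. iter_deriv k F y (\<lambda>l. L (v l))) (L x) (L (v k)) D"
      using assms(2) unfolding bastiani_smooth_def by fast
    then have "has_dir_deriv (\<lambda>y. iter_deriv k F (L y) (\<lambda>l. L (v l))) x (v k) D"
      by (simp add: has_dir_deriv_def linear_add[OF lin] linear_scale[OF lin])
    then show "\<exists>D. has_dir_deriv (\<lambda>y. iter_deriv k F (L y) (\<lambda>l. L (v l))) x (v k) D" ..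
  next
    fix k
    have "continuous_on (L -` U \<times> UNIV) (\<lambda>p. (L (fst p), \<lambda>l. L (snd p l)))"
    proof (rule continuous_on_Pair)
      show "continuous_on (L -` U \<times> UNIV) (\<lambda>p. L (fst p))"
        by (rule continuous_on_compose2[OF cont[of UNIV]])
          (simp_all add: continuous_on_fst continuous_on_id)
      show "continuous_on (L -` U \<times> UNIV) (\<lambda>p l. L (snd p l))"
        by (rule continuous_on_coordinatewise_then_product,
            rule continuous_on_compose2[OF cont[of UNIV]]) (simp_all add: continuous_on_snd_apply)
    qed
    then have "continuous_on (L -` U \<times> UNIV)
        (\<lambda>p. case (L (fst p), \<lambda>l. L (snd p l)) of (x, v) \<Rightarrow> iter_deriv k F x v)"
      by (rule continuous_on_compose2[of "U \<times> UNIV" "\<lambda>q. case q of (x, v) \<Rightarrow> iter_deriv k F x v", rotated])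
        (use assms(2) in \<open>auto simp: bastiani_smooth_def\<close>)
    then show "continuous_on (L -` U \<times> UNIV) (\<lambda>(x, v). iter_deriv k F (L x) (\<lambda>l. L (v l)))"
      by (simp add: case_prod_beta)
  qed
qed

text \<open>A spatial rotation has conformal factor 1 and acts linearly on the sphere, so
  \<open>sigma\<close> reduces to composition with the inverse rotation. Preservation of the norm
  keeps the extension by 0 consistent.\<close>

lemma sphere_apply_sigma_rot:
  fixes f :: "'n::finite sphere_fun"
  assumes "i \<noteq> j"
  shows "sphere_apply (sigma (rot (Some i) (Some j) \<theta>) f) x = sphere_apply f (rot i j (- \<theta>) *v x)"
proof -
  let ?L = "\<lambda>x. rot i j (- \<theta>) *v x"
  let ?f = "\<lambda>x. sphere_apply f (?L x)"
  have "Some i \<noteq> Some j" using assms by simp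
  then have sig: "sigma (rot (Some i) (Some j) \<theta>) f
      = Abs_sphere_fun (\<lambda>x. if x \<in> sphere 0 1 then ?f x else 0)"
    using assms
    by (simp add: sigma_def matrix_inv_rot conf_factor_def sphere_action_def blocks_rot cong: if_cong)
  have out: "?f x = 0" if "x \<notin> sphere 0 1" for x
    using that by (intro sphere_apply_outside) (simp add: norm_rot[OF assms])
  have "smooth_map_on (sphere 0 1) ?f"
    unfolding smooth_map_on_def
  proof
    fix x :: "real ^ 'n" assume "x \<in> sphere 0 1"
    then have "?L x \<in> sphere 0 1" by (simp add: norm_rot[OF assms])
    then obtain U F where U: "?L x \<in> U" "bastiani_smooth U F"
        "\<forall>y\<in>sphere 0 1 \<inter> U. F y = sphere_apply f y"
      using sphere_apply[of f] unfolding smooth_map_on_def by blast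
    have "bastiani_smooth (?L -` U) (\<lambda>x. F (?L x))"
      by (rule bastiani_smooth_compose_linear[OF matrix_vector_mul_bounded_linear U(2)])
    with U show "\<exists>V G. x \<in> V \<and> bastiani_smooth V G \<and> (\<forall>y\<in>sphere 0 1 \<inter> V. G y = ?f y)"
      by (intro exI[of _ "?L -` U"] exI[of _ "\<lambda>x. F (?L x)"]) (auto simp: norm_rot[OF assms])
  qed
  moreover have "(\<lambda>x. if x \<in> sphere 0 1 then ?f x else 0) = ?f" using out by auto
  ultimately show ?thesis unfolding sig using out by (simp add: Abs_sphere_fun_inverse)
qed

text \<open>Dividing by the norm makes this constant along rays. On the sphere it is the complex
  coordinate of the plane, and the real parts of its powers are the radial extensions of the
  functions \<open>wave_fun\<close>.\<close>

definition plane_complex :: "'n \<Rightarrow> 'n \<Rightarrow> real ^ 'n::finite \<Rightarrow> complex" where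
  "plane_complex i j x = Complex (x $ i / norm x) (x $ j / norm x)"

lemma plane_complex_rot:
  assumes "i \<noteq> j"
  shows "plane_complex i j (rot i j \<theta> *v x) = cis \<theta> * plane_complex i j x"
  using assms
  by (simp add: plane_complex_def rot_vector norm_rot complex_eq_iff diff_divide_distrib add_divide_distrib)

text \<open>Real and imaginary parts share one induction because complex multiplication mixes
  them.\<close>

lemma dir_alg_plane_complex:
  "dir_alg (\<lambda>x v. Re (plane_complex i j x ^ n)) \<and> dir_alg (\<lambda>x v. Im (plane_complex i j x ^ n))"
proof (induction n)
  case 0
  show ?case by (simp add: dir_alg.const)
next
  case (Suc n)
  have "dir_alg (\<lambda>x v. (x \<bullet> axis i 1) * inverse (norm x))" "dir_alg (\<lambda>x v. (x \<bullet> axis j 1) * inverse (norm x))"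
    by (intro dir_alg.intros)+
  then have R: "dir_alg (\<lambda>x v. Re (plane_complex i j x))" and I: "dir_alg (\<lambda>x v. Im (plane_complex i j x))"
    by (simp_all add: plane_complex_def cart_eq_inner_axis divide_inverse)
  have "dir_alg (\<lambda>x v. Re (plane_complex i j x) * Re (plane_complex i j x ^ n) +
      (-1) * (Im (plane_complex i j x) * Im (plane_complex i j x ^ n)))"
    "dir_alg (\<lambda>x v. Re (plane_complex i j x) * Im (plane_complex i j x ^ n) +
      Im (plane_complex i j x) * Re (plane_complex i j x ^ n))"
    by (intro dir_alg.add dir_alg.mult dir_alg.const R I conjunct1[OF Suc] conjunct2[OF Suc])+
  then show ?case by simp
qed

definition wave_fun :: "'n \<Rightarrow> 'n \<Rightarrow> nat \<Rightarrow> 'n::finite sphere_fun" where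
  "wave_fun i j n = Abs_sphere_fun (\<lambda>x. if x \<in> sphere 0 1 then Re (plane_complex i j x ^ n) else 0)"

lemma sphere_apply_wave_fun:
  "sphere_apply (wave_fun i j n) x = (if x \<in> sphere 0 1 then Re (plane_complex i j x ^ n) else 0)"
proof -
  let ?g = "\<lambda>x. Re (plane_complex i j x ^ n)"
  have "bastiani_smooth (- {0}) ?g"
    using dir_alg_plane_complex[of i j n] by (intro dir_alg_bastiani_smooth) auto
  then have "smooth_map_on (sphere 0 1) (\<lambda>x. if x \<in> sphere 0 1 then ?g x else 0)"
    unfolding smooth_map_on_def by (intro ballI exI[of _ "- {0}"] exI[of _ ?g]) auto
  then show ?thesis unfolding wave_fun_def by (subst Abs_sphere_fun_inverse) auto
qed

lemma continuous_on_scaleR_wave_fun: "continuous_on UNIV (\<lambda>r::real. r *\<^sub>R wave_fun i j n)"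
proof (rule continuous_on_scaleR_sphere_fun)
  show "dir_alg (\<lambda>x v. Re (plane_complex i j x ^ n))"
    using dir_alg_plane_complex by blast
  show "radial_ext (wave_fun i j n) x = Re (plane_complex i j x ^ n)" if "x \<noteq> 0" for x
    using that by (simp add: radial_ext_def sphere_apply_wave_fun norm_sgn plane_complex_def)
      (simp add: sgn_div_norm divide_inverse mult.commute)
qed


section \<open>Exponential functions of the BMS group\<close>

lemma has_dir_deriv_Pair:
  assumes "has_dir_deriv f x v D" "has_dir_deriv g x v D'"
  shows "has_dir_deriv (\<lambda>y. (f y, g y)) x v (D, D')"
  using tendsto_Pair[OF assms[unfolded has_dir_deriv_def]]
  by (simp add: has_dir_deriv_def)

text \<open>The real difference quotients of \<open>p\<close> converge, and the assumed continuity
  of scaling along \<open>f\<close> carries this limit into the target space.\<close>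

lemma has_dir_deriv_scaleR_const:
  fixes p :: "'a::real_vector \<Rightarrow> real" and f :: "'b::{real_vector,t2_space}"
  assumes "continuous_on UNIV (\<lambda>r::real. r *\<^sub>R f)" "has_dir_deriv p x v D"
  shows "has_dir_deriv (\<lambda>y. p y *\<^sub>R f) x v (D *\<^sub>R f)"
proof -
  have "((\<lambda>t. ((p (x + t *\<^sub>R v) - p x) /\<^sub>R t) *\<^sub>R f) \<longlongrightarrow> D *\<^sub>R f) (at 0)"
    using assms(2) unfolding has_dir_deriv_def
    by (rule continuous_on_tendsto_compose[OF assms(1)]) auto
  moreover have "((p (x + t *\<^sub>R v) - p x) /\<^sub>R t) *\<^sub>R f
      = (p (x + t *\<^sub>R v) *\<^sub>R f - p x *\<^sub>R f) /\<^sub>R t" for t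
    by (simp add: scaleR_left_diff_distrib[symmetric])
  ultimately show ?thesis by (simp only: has_dir_deriv_def)
qed

text \<open>All iterated derivatives are given in closed form, as \<open>p\<close> times
  \<open>f\<close> in the first component and as \<open>M\<close> in the second.\<close>

lemma bastiani_smooth_line_rot:
  fixes f :: "'b::{real_vector,t2_space}"
  assumes cont: "continuous_on UNIV (\<lambda>r::real. r *\<^sub>R f)"
  shows "bastiani_smooth UNIV (\<lambda>t::real. (t *\<^sub>R f, rot i j (\<theta> * t)))"
proof -
  let ?A = "rot_gen i j" let ?B = "?A ** ?A" let ?\<gamma> = "\<lambda>t::real. (t *\<^sub>R f, rot i j (\<theta> * t))"
  define p where "p k t v = (if k = 0 then t else if k = 1 then v 0 else 0)"
    for k :: nat and t :: real and v :: "nat \<Rightarrow> real"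
  \<comment> \<open>With \<open>B = A ** A\<close>, the rotation is
    \<open>1 + B + sin A - cos B\<close>. Each derivative drops the constant part, advances the
    phase by \<open>pi / 2\<close> and contributes a factor \<open>\<theta>\<close> and a
    direction.\<close>
  define M where "M k t v = (if k = 0 then mat 1 + ?B else 0) + ((\<Prod>l<k. v l) * \<theta> ^ k) *\<^sub>R
    (sin (\<theta> * t + k * pi / 2) *\<^sub>R ?A - cos (\<theta> * t + k * pi / 2) *\<^sub>R ?B)"
    for k :: nat and t :: real and v :: "nat \<Rightarrow> real"
  have dp: "has_dir_deriv (\<lambda>t. p k t v) t (v k) (p (Suc k) t v)" for k t v
    unfolding has_dir_deriv_real_iff p_def by (auto intro!: derivative_eq_intros)
  have shift: "sin (\<theta> * t + real (Suc k) * pi / 2) = cos (\<theta> * t + k * pi / 2)"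
    "cos (\<theta> * t + real (Suc k) * pi / 2) = - sin (\<theta> * t + k * pi / 2)" for k t
  proof -
    have "\<theta> * t + real (Suc k) * pi / 2 = (\<theta> * t + k * pi / 2) + pi / 2"
      by (simp add: algebra_simps add_divide_distrib)
    then show "sin (\<theta> * t + real (Suc k) * pi / 2) = cos (\<theta> * t + k * pi / 2)"
      "cos (\<theta> * t + real (Suc k) * pi / 2) = - sin (\<theta> * t + k * pi / 2)"
      by (simp_all only: sin_add cos_add sin_pi_half cos_pi_half) simp_all
  qed
  have dM: "has_dir_deriv (\<lambda>t. M k t v) t (v k) (M (Suc k) t v)" for k t v
    unfolding has_dir_deriv_vector_iff M_def shift
    by (auto intro!: derivative_eq_intros simp: algebra_simps)
  have d: "has_dir_deriv (\<lambda>t. (p k t v *\<^sub>R f, M k t v)) t (v k) (p (Suc k) t v *\<^sub>R f, M (Suc k) t v)"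
    for k t v
    by (intro has_dir_deriv_Pair has_dir_deriv_scaleR_const cont dp dM)
  have iter: "iter_deriv k ?\<gamma> t v = (p k t v *\<^sub>R f, M k t v)" for k t v
  proof (induction k arbitrary: t)
    case 0
    show ?case by (simp add: p_def M_def rot_def algebra_simps)
  next
    case (Suc k)
    show ?case using dir_deriv_eqI[OF d] by (simp add: Suc)
  qed
  show ?thesis
    unfolding bastiani_smooth_def iter
  proof (intro conjI allI ballI)
    fix k
    have "continuous_on UNIV (\<lambda>q. p k (fst q) (snd q))"
      unfolding p_def
      by (cases "k = 0"; cases "k = 1")
        (simp_all add: continuous_on_snd_apply continuous_on_fst continuous_on_id)
    then have "continuous_on UNIV (\<lambda>q. p k (fst q) (snd q) *\<^sub>R f)"
      by (rule continuous_on_compose2[OF cont]) auto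
    moreover have "continuous_on UNIV (\<lambda>q. M k (fst q) (snd q))"
      unfolding M_def
      by (intro continuous_on_add continuous_on_scaleR continuous_on_mult continuous_on_prod
          continuous_on_diff continuous_on_sin continuous_on_cos continuous_on_const
          continuous_on_snd_apply continuous_on_fst continuous_on_id)
    ultimately show "continuous_on (UNIV \<times> UNIV) (\<lambda>(t, v). (p k t v *\<^sub>R f, M k t v))"
      by (simp add: case_prod_beta continuous_on_Pair)
  qed (use d in blast)+
qed

text \<open>Membership asks only for a smooth curve with the right velocity at 0. A straight line in
  the function component, paired with a rotation, suffices and need not be a one-parameter
  group.\<close>

lemma lie_algebra_BMS_memI:
  fixes f :: "'n::finite sphere_fun"
  assumes cont: "continuous_on UNIV (\<lambda>r::real. r *\<^sub>R f)" and "i \<noteq> j"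
  shows "(f, \<theta> *\<^sub>R rot_gen (Some i) (Some j)) \<in> lie_algebra (BMS TYPE('n))"
proof -
  let ?\<gamma> = "\<lambda>t::real. (t *\<^sub>R f, rot (Some i) (Some j) (\<theta> * t))"
  have ij: "Some i \<noteq> Some j" using assms(2) by simp
  have "has_dir_deriv (\<lambda>t. rot (Some i) (Some j) (\<theta> * t)) 0 1 (\<theta> *\<^sub>R rot_gen (Some i) (Some j))"
    using has_vector_derivative_rot[OF ij, of \<theta> 0] by (simp add: has_dir_deriv_vector_iff rot_zero)
  moreover have "has_dir_deriv (\<lambda>t::real. t *\<^sub>R f) 0 1 (1 *\<^sub>R f)"
    by (rule has_dir_deriv_scaleR_const[OF cont])
      (auto simp: has_dir_deriv_real_iff intro!: derivative_eq_intros)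
  ultimately have "has_dir_deriv ?\<gamma> 0 1 (f, \<theta> *\<^sub>R rot_gen (Some i) (Some j))"
    by (auto intro: has_dir_deriv_Pair)
  moreover have "range ?\<gamma> \<subseteq> carrier (BMS TYPE('n))"
    using rot_in_SO0[OF assms(2)] by (auto simp: BMS_def semidirect_def)
  moreover have "?\<gamma> 0 = \<one>\<^bsub>BMS TYPE('n)\<^esub>"
    by (simp add: BMS_def semidirect_def SO0_def rot_zero)
  ultimately show ?thesis
    using bastiani_smooth_line_rot[OF cont, of "Some i" "Some j" \<theta>]
    unfolding lie_algebra_def by (intro CollectI exI[of _ ?\<gamma>] conjI)
qed

text \<open>At a fixed point \<open>x\<close> the group law gives the function component an explicit
  derivative in \<open>s\<close>, a trigonometric function of period 1 and mean 0. Comparison with a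
  periodic antiderivative replaces integration.\<close>

lemma exponential_wave_fun:
  fixes i j :: "'n::finite" and c :: real
  assumes e: "exponential_function (BMS TYPE('n)) e" and ij: "i \<noteq> j" and "n > 0"
    and X: "(c *\<^sub>R wave_fun i j n, (2 * pi / n) *\<^sub>R rot_gen (Some i) (Some j)) \<in> lie_algebra (BMS TYPE('n))"
  shows "e (c *\<^sub>R wave_fun i j n, (2 * pi / n) *\<^sub>R rot_gen (Some i) (Some j))
    = (0, rot (Some i) (Some j) (2 * pi / n))"
proof -
  define \<theta> where "\<theta> = 2 * pi / n"
  define Y where "Y = (c *\<^sub>R wave_fun i j n, \<theta> *\<^sub>R rot_gen (Some i) (Some j))"
  define F where "F t = fst (e (t *\<^sub>R Y))" for t
  define g where "g t = snd (e (t *\<^sub>R Y))" for t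
  have sij: "Some i \<noteq> Some j" using ij by simp
  have Y: "Y \<in> lie_algebra (BMS TYPE('n))" using X by (simp add: Y_def \<theta>_def)
  have hom: "e ((s + t) *\<^sub>R Y) = e (s *\<^sub>R Y) \<otimes>\<^bsub>BMS TYPE('n)\<^esub> e (t *\<^sub>R Y)" for s t
    using e Y unfolding exponential_function_def by blast
  have F_add: "F (s + t) = F s + sigma (g s) (F t)" and g_add: "g (s + t) = g s ** g t" for s t
    unfolding F_def g_def hom by (simp_all add: BMS_def semidirect_def SO0_def case_prod_beta)
  have "e (0 *\<^sub>R Y) = \<one>\<^bsub>BMS TYPE('n)\<^esub>"
    using e Y unfolding exponential_function_def by blast
  then have F0: "F 0 = 0" and g0: "g 0 = mat 1"
    by (simp_all add: F_def g_def BMS_def semidirect_def SO0_def)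
  have "has_dir_deriv (\<lambda>t::real. e (t *\<^sub>R Y)) 0 1 Y"
    using e Y unfolding exponential_function_def by blast
  then have lim: "((\<lambda>t. (e (t *\<^sub>R Y) - e (0 *\<^sub>R Y)) /\<^sub>R t) \<longlongrightarrow> Y) (at 0)"
    by (simp add: has_dir_deriv_def)
  have F_lim: "((\<lambda>t. F t /\<^sub>R t) \<longlongrightarrow> c *\<^sub>R wave_fun i j n) (at 0)"
  proof -
    have "((\<lambda>t. (F t - F 0) /\<^sub>R t) \<longlongrightarrow> fst Y) (at 0)"
      using tendsto_fst[OF lim] by (simp add: F_def)
    then show ?thesis by (simp add: F0 Y_def)
  qed
  have "has_dir_deriv g 0 1 (\<theta> *\<^sub>R rot_gen (Some i) (Some j))"
    using tendsto_snd[OF lim] by (simp add: has_dir_deriv_def g_def Y_def)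
  then have g: "g t = rot (Some i) (Some j) (\<theta> * t)" for t
    using one_parameter_group_rot[OF sij g_add g0] by (simp add: has_dir_deriv_vector_iff)
  have "sphere_apply (F 1) x = 0" for x
  proof (cases "x \<in> sphere 0 1")
    case True
    let ?z = "plane_complex i j x ^ n"
    \<comment> \<open>An antiderivative of the velocity found below; it takes equal values at 0 and
      1.\<close>
    let ?G = "\<lambda>s. c * (Re ?z * sin (2 * pi * s) - Im ?z * cos (2 * pi * s)) / (2 * pi)"
    have dF: "((\<lambda>s. sphere_apply (F s) x) has_real_derivative
        c * (Re ?z * cos (2 * pi * s) + Im ?z * sin (2 * pi * s))) (at s)" for s
    proof -
      let ?y = "rot i j (- (\<theta> * s)) *v x"
      have "?y \<in> sphere 0 1" using True by (simp add: norm_rot[OF ij])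
      \<comment> \<open>De Moivre's formula turns the angle \<open>2 * pi / n\<close> into a full
        turn; \<open>n > 0\<close> allows the cancellation.\<close>
      moreover have "cis (- (\<theta> * s)) ^ n = cis (- (2 * pi * s))"
        unfolding Complex.DeMoivre using assms(3) by (simp add: \<theta>_def)
      ultimately have wave: "sphere_apply (wave_fun i j n) ?y
          = Re ?z * cos (2 * pi * s) + Im ?z * sin (2 * pi * s)"
        by (simp add: sphere_apply_wave_fun plane_complex_rot[OF ij] power_mult_distrib)
      have "((\<lambda>h. sphere_apply (F h /\<^sub>R h) ?y) \<longlongrightarrow> sphere_apply (c *\<^sub>R wave_fun i j n) ?y) (at 0)"
        by (rule tendsto_sphere_apply[OF F_lim])
      \<comment> \<open>By the cocycle rule \<open>F_add\<close>, the difference quotient at time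
        \<open>s\<close> is the quotient at time 0 evaluated at the rotated point.\<close>
      moreover have "sphere_apply (F h /\<^sub>R h) ?y = (sphere_apply (F (s + h)) x - sphere_apply (F s) x) / h" for h
        by (simp add: F_add g sphere_apply_add sphere_apply_scaleR sphere_apply_sigma_rot[OF ij]
            divide_inverse mult.commute)
      ultimately show ?thesis by (simp add: DERIV_def sphere_apply_scaleR wave)
    qed
    have dG: "(?G has_real_derivative
        c * (Re ?z * cos (2 * pi * s) + Im ?z * sin (2 * pi * s))) (at s)" for s
      by (auto intro!: derivative_eq_intros simp: field_simps)
    have "((\<lambda>s. sphere_apply (F s) x - ?G s) has_real_derivative 0) (at s)" for s
      using DERIV_diff[OF dF dG] by simp
    then have "sphere_apply (F 1) x - ?G 1 = sphere_apply (F 0) x - ?G 0"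
      by (rule DERIV_isconst_all[OF allI])
    then show ?thesis by (simp add: F0 sphere_apply_zero)
  qed (simp add: sphere_apply_outside)
  then have "F 1 = 0" by (simp add: sphere_apply_inject[symmetric] fun_eq_iff sphere_apply_zero)
  moreover have "g 1 = rot (Some i) (Some j) \<theta>" by (simp add: g)
  ultimately show ?thesis
    unfolding \<theta>_def[symmetric] by (simp add: F_def g_def Y_def prod_eq_iff)
qed

section \<open>Failure of injectivity near 0\<close>

lemma wave_fun_nonzero:
  assumes "i \<noteq> j"
  shows "wave_fun i j n \<noteq> 0"
proof
  assume "wave_fun i j n = 0"
  then have "sphere_apply (wave_fun i j n) (axis i 1) = 0" by (simp add: sphere_apply_zero)
  \<comment> \<open>At this point of the sphere the wave function has the value 1.\<close>
  moreover have "plane_complex i j (axis i 1) = 1"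
    using assms by (simp add: plane_complex_def complex_eq_iff) (simp add: axis_def)
  ultimately show False by (simp add: sphere_apply_wave_fun)
qed

lemma not_locally_exponential_BMS:
  fixes i j :: "'n::finite"
  assumes "i \<noteq> j"
  shows "\<not> locally_exponential (BMS TYPE('n))"
proof
  assume "locally_exponential (BMS TYPE('n))"
  then obtain e U V where e: "exponential_function (BMS TYPE('n)) e"
    and U: "openin (top_of_set (lie_algebra (BMS TYPE('n)))) U" "0 \<in> U" and inj: "inj_on e U"
    unfolding locally_exponential_def diffeo_between_def bij_betw_def by blast
  let ?A = "rot_gen (Some i) (Some j)"
  let ?X = "\<lambda>n c. (c *\<^sub>R wave_fun i j n, (2 * pi / real n) *\<^sub>R ?A)"
  obtain W where W: "open W" "U = lie_algebra (BMS TYPE('n)) \<inter> W"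
    using U(1) by (auto simp: openin_open)
  have X: "?X n c \<in> lie_algebra (BMS TYPE('n))" for n c
  proof (rule lie_algebra_BMS_memI[OF _ assms])
    have "continuous_on UNIV (\<lambda>r. (r * c) *\<^sub>R wave_fun i j n)"
      by (rule continuous_on_compose2[OF continuous_on_scaleR_wave_fun]) (auto intro!: continuous_intros)
    then show "continuous_on UNIV (\<lambda>r. r *\<^sub>R c *\<^sub>R wave_fun i j n)" by simp
  qed
  have "((\<lambda>n. (0::'n sphere_fun, (2 * pi / real n) *\<^sub>R ?A)) \<longlonglongrightarrow> (0, 0 *\<^sub>R ?A))"
    by (intro tendsto_intros lim_const_over_n)
  moreover have "(0, 0 *\<^sub>R ?A) \<in> W" using U(2) W(2) by (simp add: zero_prod_def)
  ultimately have "\<forall>\<^sub>F n in sequentially. (0::'n sphere_fun, (2 * pi / real n) *\<^sub>R ?A) \<in> W"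
    using W(1) by (auto simp: tendsto_def)
  \<comment> \<open>First \<open>n\<close> is fixed with amplitude 0; the amplitude \<open>c\<close>
    is chosen afterwards and may depend on \<open>n\<close>.\<close>
  then have "\<forall>\<^sub>F n in sequentially. n > 0 \<and> ?X n 0 \<in> W"
    using eventually_gt_at_top[of "0::nat"] by eventually_elim simp
  then obtain n where n: "n > 0" "?X n 0 \<in> W"
    using eventually_happens'[OF sequentially_bot] by blast
  have "((\<lambda>c. ?X n c) \<longlongrightarrow> ?X n 0) (at 0)"
    using continuous_on_scaleR_wave_fun[of i j n]
    unfolding continuous_on_def by (intro tendsto_Pair tendsto_const) blast
  then have "\<forall>\<^sub>F c in at 0. ?X n c \<in> W"
    using W(1) n(2) by (auto simp: tendsto_def)
  \<comment> \<open>The limit is taken over the punctured neighborhood, which supplies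
    \<open>c \<noteq> 0\<close>.\<close>
  then have "\<forall>\<^sub>F c in at 0. c \<noteq> 0 \<and> ?X n c \<in> W"
    using eventually_neq_at_within[of 0 0 UNIV] by eventually_elim simp
  then obtain c where c: "c \<noteq> 0" "?X n c \<in> W"
    using eventually_happens'[OF at_neq_bot] by blast
  \<comment> \<open>The value given by \<open>exponential_wave_fun\<close> is independent of the
    amplitude.\<close>
  have "e (?X n c) = e (?X n 0)"
    using exponential_wave_fun[OF e assms n(1) X] by metis
  then have "?X n c = ?X n 0"
    using inj n(2) c(2) X W(2) unfolding inj_on_def by blast
  then show False using c(1) wave_fun_nonzero[OF assms, of n] by simp
qed

theorem theorem4p5:
  fixes d :: nat
  assumes "d \<ge> 2" and "CARD('n::finite) = d + 1"
  shows "\<not> locally_exponential (BMS TYPE('n)) \<and> \<not> locally_exponential (BMS TYPE(3))"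
proof
  have "\<not> card (UNIV :: 'n set) \<le> Suc 0" using assms by simp
  then obtain i j :: 'n where "i \<noteq> j" by (auto simp: card_le_Suc0_iff_eq)
  then show "\<not> locally_exponential (BMS TYPE('n))" by (rule not_locally_exponential_BMS)
  \<comment> \<open>The type \<open>3\<close> has three elements, so this is the group of the
    2-sphere.\<close>
  have "(0::3) \<noteq> 1" by simp
  then show "\<not> locally_exponential (BMS TYPE(3))" by (rule not_locally_exponential_BMS)
qed

end
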